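(* Let $d$ be a positive integer and $\chi$ a primitive Dirichlet character of conductor $d$. Let $w_1,w_2,w_3$ be any positive integers, $y_1,y_2,y_3\in\mathbb{Z}_p$, and $n\ge 0$ an integer. Then \begin{align*} &\sum_{k+l+m=n}\binom{n}{k,l,m}B_{k,\chi}(w_{1}y_{1})B_{l,\chi}(w_{2}y_{2})B_{m,\chi}(w_{3}y_{3})w_{1}^{l+m}w_{2}^{k+m}w_{3}^{k+l}\\ =&\sum_{k+l+m=n}\binom{n}{k,l,m}B_{k,\chi}(w_{1}y_{1})B_{l,\chi}(w_{3}y_{2})B_{m,\chi}(w_{2}y_{3})w_{1}^{l+m}w_{3}^{k+m}w_{2}^{k+l}\\ =&\sum_{k+l+m=n}\binom{n}{k,l,m}B_{k,\chi}(w_{2}y_{1})B_{l,\chi}(w_{1}y_{2})B_{m,\chi}(w_{3}y_{3})w_{2}^{l+m}w_{1}^{k+m}w_{3}^{k+l}\\ =&\sum_{k+l+m=n}\binom{n}{k,l,m}B_{k,\chi}(w_{2}y_{1})B_{l,\chi}(w_{3}y_{2})B_{m,\chi}(w_{1}y_{3})w_{2}^{l+m}w_{3}^{k+m}w_{1}^{k+l}\\ =&\sum_{k+l+m=n}\binom{n}{k,l,m}B_{k,\chi}(w_{3}y_{1})B_{l,\chi}(w_{1}y_{2})B_{m,\chi}(w_{2}y_{3})w_{3}^{l+m}w_{1}^{k+m}w_{2}^{k+l}\\ =&\sum_{k+l+m=n}\binom{n}{k,l,m}B_{k,\chi}(w_{3}y_{1})B_{l,\chi}(w_{2}y_{2})B_{m,\chi}(w_{1}y_{3})w_{3}^{l+m}w_{2}^{k+m}w_{1}^{k+l}.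 \end{align*}
   Context: $p$ is a fixed prime, $\mathbb{Z}_p$ the $p$-adic integers; algebraic numbers are viewed in $\mathbb{C}_p$ via a fixed embedding $\overline{\mathbb{Q}}\to\mathbb{C}_p$. The character $\chi$ is regarded as a function on integers (periodic mod $d$, with $\chi(a)=0$ when $\gcd(a,d)>1$; for $d=1$, $\chi\equiv 1$). The generalized Bernoulli polynomials $B_{n,\chi}(x)$ are defined by $\frac{te^{xt}}{e^{dt}-1}\sum_{a=0}^{d-1}\chi(a)e^{at}=\sum_{n\ge0}B_{n,\chi}(x)\frac{t^n}{n!}$. The sums are over all nonnegative integers $k,l,m$ with $k+l+m=n$, and $\binom{n}{k,l,m}=\frac{n!}{k!\,l!\,m!}$. *)

theory Defs
  imports
    "HOL-Analysis.Elementary_Metric_Spaces"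
    "HOL-Computational_Algebra.Computational_Algebra"
    "HOL-Number_Theory.Cong"
begin

definition padic_abs_rat :: "nat \<Rightarrow> rat \<Rightarrow> real" where
  "padic_abs_rat p q =
     (if q = 0 then 0
      else case quotient_of q of (a, b) \<Rightarrow>
        real p powi (int (multiplicity (int p) b) - int (multiplicity (int p) a)))"

(* The p-adic numbers are the topological closure of the rationals inside the ambient
   complete field, the p-adic integers their closed unit ball. *)

abbreviation Q_p :: "'k :: {field_char_0, topological_space} set" where
  "Q_p \<equiv> closure \<rat>"

definition algebraic_over_Q_p :: "'k :: {field_char_0, topological_space} \<Rightarrow> bool" where
  "algebraic_over_Q_p x \<longleftrightarrow>
     (\<exists>P :: 'k poly. P \<noteq> 0 \<and> (\<forall>i. coeff P i \<in> Q_p) \<and> poly P x = 0)"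

(* C_p is only determined up to isometric isomorphism: it is the completion of an algebraic
   closure of the completion of the rationals with respect to the p-adic absolute value.
   The locale says that the type 'k with the absolute value absv is such a field; completeness
   and algebraic closedness are part of the sort of 'k. *)

locale padic_complex_field =
  fixes p :: nat
    and absv :: "'k :: {alg_closed_field, field_char_0, complete_space} \<Rightarrow> real"
  assumes prime_p: "prime p"
    and absv_mult: "absv (x * y) = absv x * absv y"
    and absv_add_le_max: "absv (x + y) \<le> max (absv x) (absv y)"
    and absv_of_rat: "absv (of_rat q) = padic_abs_rat p q"
    and dist_eq_absv: "dist x y = absv (x - y)"
    and algebraic_dense: "closure {x :: 'k. algebraic_over_Q_p x} = UNIV"

definition Z_p :: "('k :: {field_char_0, topological_space} \<Rightarrow> real) \<Rightarrow> 'k set" where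
  "Z_p absv = {x \<in> Q_p. absv x \<le> 1}"

(* The field of algebraic numbers is taken as the set of algebraic complex numbers; values of
   the embedding at transcendental arguments are irrelevant. *)

definition algebraic_number_embedding :: "(complex \<Rightarrow> 'k :: field) \<Rightarrow> bool" where
  "algebraic_number_embedding \<iota> \<longleftrightarrow>
     \<iota> 1 = 1 \<and>
     (\<forall>x y. algebraic x \<longrightarrow> algebraic y \<longrightarrow>
        \<iota> (x + y) = \<iota> x + \<iota> y \<and> \<iota> (x * y) = \<iota> x * \<iota> y)"

definition dirichlet_character :: "nat \<Rightarrow> (int \<Rightarrow> complex) \<Rightarrow> bool" where
  "dirichlet_character d \<chi> \<longleftrightarrow>
     (\<forall>a. \<chi> (a + int d) = \<chi> a) \<and>
     (\<forall>a b. \<chi> (a * b) = \<chi> a * \<chi> b) \<and>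
     (\<forall>a. \<chi> a = 0 \<longleftrightarrow> \<not> coprime a (int d))"

(* The divisors e of the modulus d such that the character is induced from modulus e,
   i.e. factors through the units modulo e. *)

definition induced_modulus :: "nat \<Rightarrow> (int \<Rightarrow> complex) \<Rightarrow> nat \<Rightarrow> bool" where
  "induced_modulus d \<chi> e \<longleftrightarrow>
     e dvd d \<and> (\<forall>a. coprime a (int d) \<longrightarrow> [a = 1] (mod int e) \<longrightarrow> \<chi> a = 1)"

definition conductor :: "nat \<Rightarrow> (int \<Rightarrow> complex) \<Rightarrow> nat" where
  "conductor d \<chi> = (LEAST e. induced_modulus d \<chi> e)"

definition primitive_dirichlet_character :: "nat \<Rightarrow> (int \<Rightarrow> complex) \<Rightarrow> bool" where
  "primitive_dirichlet_character d \<chi> \<longleftrightarrow> dirichlet_character d \<chi> \<and> conductor d \<chi> = d"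

(* Division of formal power series: the denominator has order 1 in t when d > 0, and the
   numerator is divisible by t. *)

definition gen_bernoulli_fps :: "nat \<Rightarrow> (int \<Rightarrow> 'k :: field_char_0) \<Rightarrow> 'k \<Rightarrow> 'k fps" where
  "gen_bernoulli_fps d \<chi> x =
     fps_X * fps_exp x / (fps_exp (of_nat d) - 1) *
     (\<Sum>a<d. fps_const (\<chi> (int a)) * fps_exp (of_nat a))"

definition gen_bernoulli :: "nat \<Rightarrow> (int \<Rightarrow> 'k :: field_char_0) \<Rightarrow> nat \<Rightarrow> 'k \<Rightarrow> 'k" where
  "gen_bernoulli d \<chi> n x = fact n * fps_nth (gen_bernoulli_fps d \<chi> x) n"

lemma gen_bernoulli_generating_function:
  fixes \<chi> :: "int \<Rightarrow> 'k :: field_char_0"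
  assumes "d > 0"
  shows "Abs_fps (\<lambda>n. gen_bernoulli d \<chi> n x / fact n) * (fps_exp (of_nat d) - 1) =
           fps_X * fps_exp x * (\<Sum>a<d. fps_const (\<chi> (int a)) * fps_exp (of_nat a))"
proof -
  define g :: "'k fps" where "g = fps_exp (of_nat d) - 1"
  define f where "f = fps_X * fps_exp x"
  define c where "c = (\<Sum>a<d. fps_const (\<chi> (int a)) * fps_exp (of_nat a))"
  have nth: "fps_nth g 1 \<noteq> 0" "fps_nth g 0 = 0"
    using assms by (auto simp: g_def)
  then have sd: "subdegree g = 1"
    by (intro subdegreeI) auto
  have "fps_nth f 0 = 0" "g \<noteq> 0"
    using nth by (auto simp: f_def)
  then have "f = 0 \<or> subdegree f \<noteq> 0"
    using nth_subdegree_nonzero[of f] by metis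
  then have "g dvd f"
    using sd \<open>g \<noteq> 0\<close> by (cases "f = 0") (auto simp: fps_dvd_iff)
  then have div: "f div g * g = f"
    by (rule dvd_div_mult_self)
  have "Abs_fps (\<lambda>n. gen_bernoulli d \<chi> n x / fact n) = gen_bernoulli_fps d \<chi> x"
    by (rule fps_ext) (simp add: gen_bernoulli_def)
  also have "\<dots> = f div g * c"
    by (simp only: gen_bernoulli_fps_def f_def g_def c_def)
  also have "f div g * c * g = (f div g * g) * c"
    by (simp only: mult_ac)
  finally show ?thesis
    by (simp only: div) (simp only: f_def g_def c_def)
qed

end

theory Submission
  imports Defs
begin

text \<open>
  Write \<open>F(x; t)\<close> for the generating function of the generalized Bernoulli polynomials, so
  \<open>F(x; t) = e^(x t) F(0; t)\<close>. Since \<open>u^(l+m) v^(k+m) w^(k+l) = (v w)^k (u w)^l (u v)^m\<close>,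
  the sum for \<open>(u, v, w)\<close> is \<open>n!\<close> times the coefficient of \<open>t^n\<close> in
  \<open>F(u y1; v w t) F(v y2; u w t) F(w y3; u v t)
     = e^(u v w (y1 + y2 + y3) t) F(0; v w t) F(0; u w t) F(0; u v t)\<close>,
  which is symmetric in \<open>u, v, w\<close>.
\<close>

text \<open>The constant term vanishes and the linear one is \<open>c\<close>, so the series is
  \<open>fps_X\<close> times a unit. Hence the \<open>div\<close> in
  \<open>gen_bernoulli_fps\<close> is exact when \<open>d > 0\<close>.\<close>

lemma fps_exp_minus_one_dvd_fps_X:
  fixes c :: "'a :: field_char_0"
  assumes "c \<noteq> 0"
  shows "fps_exp c - 1 dvd fps_X"
proof -
  have "subdegree (fps_exp c - 1) = 1"
    using assms by (intro subdegreeI) auto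
  moreover from this have "fps_exp c - 1 \<noteq> 0"
    by force
  ultimately show ?thesis
    by (simp add: fps_dvd_iff)
qed

lemma gen_bernoulli_fps_eq_exp_mult:
  assumes "d > 0"
  shows "gen_bernoulli_fps d \<chi> x = fps_exp x * gen_bernoulli_fps d \<chi> 0"
proof -
  define g :: "'a fps" where "g = fps_exp (of_nat d) - 1"
  have "g dvd fps_X"
    unfolding g_def by (rule fps_exp_minus_one_dvd_fps_X) (use assms in simp)
  \<comment> \<open>Division of power series can truncate; exactness of \<open>fps_X div g\<close>
    justifies pulling \<open>fps_exp x\<close> out.\<close>
  then have "fps_X * fps_exp x div g = fps_X div g * fps_exp x"
    by (rule dvd_div_mult [symmetric])
  then show ?thesis
    by (simp add: gen_bernoulli_fps_def g_def mult_ac)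
qed

text \<open>Substituting \<open>c t\<close> for \<open>t\<close> turns e^(x t) into e^(c x t), so
  \<open>x\<close> still enters only through an exponential.\<close>

lemma gen_bernoulli_fps_compose_linear:
  assumes "d > 0"
  shows "gen_bernoulli_fps d \<chi> x oo (fps_const c * fps_X) =
         fps_exp (c * x) * (gen_bernoulli_fps d \<chi> 0 oo (fps_const c * fps_X))"
  by (subst gen_bernoulli_fps_eq_exp_mult [OF assms]) (simp add: fps_compose_mult_distrib)

lemma fps_mult3_nth:
  fixes f g h :: "'a :: comm_semiring_0 fps"
  shows "fps_nth (f * g * h) n =
         (\<Sum>(k, l, m) \<in> {(k, l, m). k + l + m = n}. fps_nth f k * fps_nth g l * fps_nth h m)"
proof -
  have "fps_nth (f * g * h) n =
        (\<Sum>i\<le>n. \<Sum>k\<le>i. fps_nth f k * fps_nth g (i - k) * fps_nth h (n - i))"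
    by (simp add: fps_mult_nth sum_distrib_right atLeast0AtMost)
  also have "\<dots> = (\<Sum>(i, k) \<in> Sigma {..n} (\<lambda>i. {..i}).
                     fps_nth f k * fps_nth g (i - k) * fps_nth h (n - i))"
    by (rule sum.Sigma) auto
  also have "\<dots> = (\<Sum>(k, l, m) \<in> {(k, l, m). k + l + m = n}.
                     fps_nth f k * fps_nth g l * fps_nth h m)"
    \<comment> \<open>Here \<open>i\<close> is \<open>k + l\<close>, the degree contributed by the
      first two factors.\<close>
    by (rule sum.reindex_bij_witness
          [of _ "\<lambda>(k, l, m). (k + l, k)" "\<lambda>(i, k). (k, i - k, n - i)"]) auto
  finally show ?thesis .
qed

lemma sum_gen_bernoulli_product:
  fixes \<chi> :: "int \<Rightarrow> 'k :: field_char_0"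
  assumes "d > 0"
  defines "F \<equiv> \<lambda>c. gen_bernoulli_fps d \<chi> 0 oo (fps_const c * fps_X)"
  shows "(\<Sum>(k, l, m) \<in> {(k, l, m). k + l + m = n}.
            fact n / (fact k * fact l * fact m) *
            gen_bernoulli d \<chi> k (u * y\<^sub>1) * gen_bernoulli d \<chi> l (v * y\<^sub>2) *
            gen_bernoulli d \<chi> m (w * y\<^sub>3) * u ^ (l + m) * v ^ (k + m) * w ^ (k + l)) =
         fact n * fps_nth (fps_exp (u * v * w * (y\<^sub>1 + y\<^sub>2 + y\<^sub>3)) *
                             (F (v * w) * F (u * w) * F (u * v))) n"
proof -
  define G where "G c x = gen_bernoulli_fps d \<chi> x oo (fps_const c * fps_X)" for c x
  have G: "G c x = fps_exp (c * x) * F c" for c x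
    unfolding G_def F_def by (rule gen_bernoulli_fps_compose_linear [OF assms(1)])
  \<comment> \<open>The factor \<open>c ^ k\<close> is the source of the powers of \<open>u\<close>,
    \<open>v\<close>, \<open>w\<close> in the sum.\<close>
  have G_nth: "fps_nth (G c x) k = c ^ k * (gen_bernoulli d \<chi> k x / fact k)" for c x k
    by (simp add: G_def fps_compose_linear gen_bernoulli_def)
  \<comment> \<open>Each scale supplies the two parameters absent from its argument, as in
    \<open>(v * w) * (u * y\<^sub>1)\<close>, so all three exponents share the factor
    \<open>u * v * w\<close>.\<close>
  have eq: "fps_exp (u * v * w * (y\<^sub>1 + y\<^sub>2 + y\<^sub>3)) * (F (v * w) * F (u * w) * F (u * v)) =
        G (v * w) (u * y\<^sub>1) * G (u * w) (v * y\<^sub>2) * G (u * v) (w * y\<^sub>3)"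
    by (simp add: G fps_exp_add_mult distrib_left mult_ac)
  show ?thesis
    unfolding eq fps_mult3_nth sum_distrib_left
    by (rule sum.cong) (auto simp: G_nth power_add power_mult_distrib)
qed

theorem theorem1:
  fixes absv :: "'k :: {alg_closed_field, field_char_0, complete_space} \<Rightarrow> real"
    and \<iota> :: "complex \<Rightarrow> 'k"
    and \<chi> :: "int \<Rightarrow> complex"
    and p d w\<^sub>1 w\<^sub>2 w\<^sub>3 n :: nat
    and y\<^sub>1 y\<^sub>2 y\<^sub>3 :: 'k
  assumes "padic_complex_field p absv"
    and "algebraic_number_embedding \<iota>"
    and "d > 0"
    and "primitive_dirichlet_character d \<chi>"
    and "w\<^sub>1 > 0" and "w\<^sub>2 > 0" and "w\<^sub>3 > 0"
    and "y\<^sub>1 \<in> Z_p absv" and "y\<^sub>2 \<in> Z_p absv" and "y\<^sub>3 \<in> Z_p absv"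
  shows "let B = gen_bernoulli d (\<lambda>a. \<iota> (\<chi> a));
             S = (\<lambda>u v w :: nat. \<Sum>(k, l, m) \<in> {(k, l, m). k + l + m = n}.
                    fact n / (fact k * fact l * fact m) *
                    B k (of_nat u * y\<^sub>1) * B l (of_nat v * y\<^sub>2) * B m (of_nat w * y\<^sub>3) *
                    of_nat u ^ (l + m) * of_nat v ^ (k + m) * of_nat w ^ (k + l))
         in S w\<^sub>1 w\<^sub>2 w\<^sub>3 = S w\<^sub>1 w\<^sub>3 w\<^sub>2 \<and>
            S w\<^sub>1 w\<^sub>3 w\<^sub>2 = S w\<^sub>2 w\<^sub>1 w\<^sub>3 \<and>
            S w\<^sub>2 w\<^sub>1 w\<^sub>3 = S w\<^sub>2 w\<^sub>3 w\<^sub>1 \<and>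
            S w\<^sub>2 w\<^sub>3 w\<^sub>1 = S w\<^sub>3 w\<^sub>1 w\<^sub>2 \<and>
            S w\<^sub>3 w\<^sub>1 w\<^sub>2 = S w\<^sub>3 w\<^sub>2 w\<^sub>1"
  \<comment> \<open>All six sums become the closed form with \<open>u\<close>, \<open>v\<close>,
    \<open>w\<close> permuted and the \<open>y\<close>s fixed; only the order of commuting factors
    differs.\<close>
  unfolding Let_def sum_gen_bernoulli_product [OF \<open>d > 0\<close>]
  by (simp add: mult_ac)

end
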